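(* Let $X$ be a real Banach space with dual $X^*$, and let $T\subseteq X\times X^*$ be a maximal monotone operator. Let $h\in\mathcal{H}(T)$ be such that $h\ge\mathcal{J}h$, and let $h_0\in L(h)$, where $$L(h)=\{g\in\mathcal{H}(T) : h\ge g\ge\mathcal{J}g\}.$$ Then $h_0$ is a minimal element of $L(h)$ (with respect to the pointwise order) if and only if $h_0=\mathcal{J}h_0$.
   Context: Let $X$ be a real Banach space, $X^*$ its dual, and $\overline{\mathbb{R}}=\mathbb{R}\cup\{-\infty,+\infty\}$. Write $\langle x,x^*\rangle=x^*(x)$ for $x\in X$, $x^*\in X^*$. A point-to-set operator $T$ from $X$ to $X^*$ is identified with its graph $\{(x,x^* )\in X\times X^* : x^*\in T(x)\}$. $T$ is monotone if $\langle x-y,x^*-y^*\rangle\ge 0$ for all $(x,x^* ),(y,y^* )\in T$. It is maximal monotone if it is monotone and, whenever $(x,x^* )\in X\times X^*$ satisfies $\langle x-y,x^*-y^*\rangle\ge 0$ for all $(y,y^* )\in T$, then $(x,x^* )\in T$. For a maximal monotone operator $T$, $\mathcal{H}(T)$ denotes the family of convex lower semicontinuous functions $h:X\times X^*\to\overline{\mathbb{R}}$ such that $h(x,x^* )\ge\langle x,x^*\rangle$ for all $(x,x^* )\in X\times X^*$, and $h(x,x^* )=\langle x,x^*\rangle$ whenever $(x,x^* )\in T$. For a function $h:X\times X^*\to\overline{\mathbb{R}}$, define $\mathcal{J}h:X\times X^*\to\overline{\mathbb{R}}$ by $$\mathcal{J}h(x,x^* )=\sup_{(y,y^* )\in X\times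 X^*}\ \langle x,y^*\rangle+\langle y,x^*\rangle-h(y,y^* ).$$ Inequalities between functions are pointwise on $X\times X^*$. An element $h_0\in L(h)$ is minimal if $h'\in L(h)$ and $h_0\ge h'$ imply $h'=h_0$. *)

theory Defs
  imports "HOL-Analysis.Analysis"
begin

text \<open>
  The dual of a real Banach space \<open>'a\<close> is the Banach space \<open>'a \<Rightarrow>\<^sub>L real\<close> of bounded linear
  functionals with the operator norm; \<open>'a \<times> ('a \<Rightarrow>\<^sub>L real)\<close> carries the product of the norm
  topologies.  Operators from the space to its dual are given by their graphs.
\<close>

abbreviation pairing :: "'a::banach \<Rightarrow> ('a \<Rightarrow>\<^sub>L real) \<Rightarrow> real" where
  "pairing x xs \<equiv> blinfun_apply xs x"

definition monotone_operator :: "('a::banach \<times> ('a \<Rightarrow>\<^sub>L real)) set \<Rightarrow> bool" where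
  "monotone_operator T \<longleftrightarrow>
     (\<forall>(x, xs) \<in> T. \<forall>(y, ys) \<in> T. 0 \<le> pairing (x - y) (xs - ys))"

definition maximal_monotone :: "('a::banach \<times> ('a \<Rightarrow>\<^sub>L real)) set \<Rightarrow> bool" where
  "maximal_monotone T \<longleftrightarrow> monotone_operator T \<and>
     (\<forall>x xs. (\<forall>(y, ys) \<in> T. 0 \<le> pairing (x - y) (xs - ys)) \<longrightarrow> (x, xs) \<in> T)"

text \<open>
  Convexity of a function with values in \<open>[-\<infinity>, \<infinity>]\<close> is convexity of its epigraph, which is a
  subset of \<open>'b \<times> real\<close>; this needs no convention for \<open>\<infinity> - \<infinity>\<close>.  The library's \<open>convex_on\<close> and
  \<open>epigraph\<close> cover real-valued functions only.
\<close>

definition ereal_convex :: "('b::real_vector \<Rightarrow> ereal) \<Rightarrow> bool" where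
  "ereal_convex f \<longleftrightarrow> convex {(z, r::real). f z \<le> ereal r}"

definition lower_semicontinuous :: "('b::topological_space \<Rightarrow> ereal) \<Rightarrow> bool" where
  "lower_semicontinuous f \<longleftrightarrow> (\<forall>z c. c < f z \<longrightarrow> (\<forall>\<^sub>F w in nhds z. c < f w))"

definition convex_representations ::
    "('a::banach \<times> ('a \<Rightarrow>\<^sub>L real)) set \<Rightarrow> ('a \<times> ('a \<Rightarrow>\<^sub>L real) \<Rightarrow> ereal) set" where
  "convex_representations T =
     {h. ereal_convex h \<and> lower_semicontinuous h \<and>
         (\<forall>x xs. ereal (pairing x xs) \<le> h (x, xs)) \<and>
         (\<forall>(x, xs) \<in> T. h (x, xs) = ereal (pairing x xs))}"

text \<open>
  The subtrahend below may be infinite, but the minuend is real, so every difference has its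
  usual meaning in \<open>[-\<infinity>, \<infinity>]\<close>.
\<close>

definition conjJ ::
    "('a::banach \<times> ('a \<Rightarrow>\<^sub>L real) \<Rightarrow> ereal) \<Rightarrow> 'a \<times> ('a \<Rightarrow>\<^sub>L real) \<Rightarrow> ereal" where
  "conjJ h = (\<lambda>(x, xs). SUP (y, ys) \<in> UNIV. ereal (pairing x ys + pairing y xs) - h (y, ys))"

definition above_conjJ_family ::
    "('a::banach \<times> ('a \<Rightarrow>\<^sub>L real)) set \<Rightarrow> ('a \<times> ('a \<Rightarrow>\<^sub>L real) \<Rightarrow> ereal)
      \<Rightarrow> ('a \<times> ('a \<Rightarrow>\<^sub>L real) \<Rightarrow> ereal) set" where
  "above_conjJ_family T h = {g \<in> convex_representations T. h \<ge> g \<and> g \<ge> conjJ g}"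

definition minimal_element :: "'b::order set \<Rightarrow> 'b \<Rightarrow> bool" where
  "minimal_element A m \<longleftrightarrow> m \<in> A \<and> (\<forall>a \<in> A. m \<ge> a \<longrightarrow> a = m)"

end

theory Submission
  imports Defs
begin

text \<open>
  \<open>\<J>\<close> is the conjugation for the symmetric coupling
  \<open>[(x, x\<^sup>*), (y, y\<^sup>*)] = \<langle>x, y\<^sup>*\<rangle> + \<langle>y, x\<^sup>*\<rangle>\<close>, hence an antitone Galois connection with
  itself.  If \<open>h\<^sub>0\<close> is a fixed point and \<open>\<J> g \<le> g \<le> h\<^sub>0\<close>, then \<open>h\<^sub>0 = \<J> h\<^sub>0 \<le> \<J> g \<le> g\<close>.
  Conversely, if \<open>\<J> h\<^sub>0 z < h\<^sub>0 z\<close>, let \<open>m\<close> be \<open>h\<^sub>0\<close> with its value at \<open>z\<close> lowered to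
  \<open>c = \<J> h\<^sub>0 z\<close>.  Then \<open>\<J> m \<le> m\<close>; at \<open>z\<close> itself this is \<open>[z, z] - c \<le> c\<close>, which holds because
  \<open>\<J> h\<^sub>0\<close> majorizes the duality product by maximality of \<open>T\<close>.  So \<open>\<J> (\<J> m)\<close> is a convex
  lower semicontinuous function between \<open>\<J> m\<close> and \<open>m\<close>, it belongs to \<open>L(h)\<close>, and it is strictly
  below \<open>h\<^sub>0\<close> at \<open>z\<close>.
\<close>

definition coupling :: "'a::banach \<times> ('a \<Rightarrow>\<^sub>L real) \<Rightarrow> 'a \<times> ('a \<Rightarrow>\<^sub>L real) \<Rightarrow> real" where
  "coupling z w = pairing (fst z) (snd w) + pairing (fst w) (snd z)"

lemma coupling_commute: "coupling z w = coupling w z"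
  by (simp add: coupling_def)

lemma coupling_self: "coupling z z = 2 * pairing (fst z) (snd z)"
  by (simp add: coupling_def)

lemma bounded_linear_coupling: "bounded_linear (\<lambda>z. coupling z w)"
  unfolding coupling_def
  by (intro bounded_linear_add bounded_linear_compose[OF blinfun.bounded_linear_right]
      bounded_linear_compose[OF blinfun.bounded_linear_left] bounded_linear_fst bounded_linear_snd)

lemma pairing_diff_eq_coupling:
  "pairing (x - y) (xs - ys) = pairing x xs + pairing y ys - coupling (x, xs) (y, ys)"
  by (simp add: coupling_def blinfun.diff_left blinfun.diff_right)

lemma conjJ_eq_SUP: "conjJ f z = (SUP w. ereal (coupling z w) - f w)"
  by (simp add: conjJ_def coupling_def case_prod_beta)

lemma conjJ_le_iff: "conjJ f \<le> g \<longleftrightarrow> (\<forall>z w. ereal (coupling z w) - f w \<le> g z)"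
  by (simp add: le_fun_def conjJ_eq_SUP SUP_le_iff)

lemma coupling_minus_le_conjJ: "ereal (coupling z w) - f w \<le> conjJ f z"
  unfolding conjJ_eq_SUP by (rule SUP_upper) simp

text \<open>The minuend is real, so the exchange survives infinite \<open>a\<close> and
  \<open>b\<close>. With the symmetry of \<open>coupling\<close> it makes \<open>conjJ\<close> its
  own Galois partner.\<close>

lemma ereal_real_minus_le_swap: "ereal r - a \<le> b \<longleftrightarrow> ereal r - b \<le> (a::ereal)"
  by (cases a; cases b) auto

lemma conjJ_galois: "conjJ f \<le> g \<longleftrightarrow> conjJ g \<le> f"
  by (metis conjJ_le_iff coupling_commute ereal_real_minus_le_swap)

lemma conjJ_conjJ_le: "conjJ (conjJ f) \<le> f"
  using conjJ_galois by blast

lemma conjJ_antimono: "f \<le> g \<Longrightarrow> conjJ g \<le> conjJ f"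
  using conjJ_galois[of g "conjJ f"] conjJ_conjJ_le[of f] by (meson order_trans)

text \<open>The epigraph of a supremum is the intersection of the epigraphs. Each of these is a
  half-space if \<open>f w\<close> is finite, and empty or everything otherwise.\<close>

lemma ereal_convex_conjJ: "ereal_convex (conjJ f)"
proof -
  have "convex {(z, r::real). ereal (coupling z w) - f w \<le> ereal r}" for w
  proof (cases "f w")
    case (real s)
    have "linear (\<lambda>p. coupling (fst p) w - snd p)"
      using bounded_linear_sub[OF bounded_linear_compose[OF bounded_linear_coupling bounded_linear_fst]
          bounded_linear_snd]
      by (rule bounded_linear.linear)
    then have "convex ((\<lambda>p. coupling (fst p) w - snd p) -` {..s})"
      by (intro convex_linear_vimage) auto
    also have "(\<lambda>p. coupling (fst p) w - snd p) -` {..s}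
        = {(z, r). ereal (coupling z w) - f w \<le> ereal r}"
      using real by (auto simp: algebra_simps)
    finally show ?thesis .
  qed auto
  then have "convex (\<Inter>w. {(z, r::real). ereal (coupling z w) - f w \<le> ereal r})"
    by (intro convex_INT) auto
  also have "(\<Inter>w. {(z, r::real). ereal (coupling z w) - f w \<le> ereal r})
      = {(z, r). conjJ f z \<le> ereal r}"
    by (auto simp: conjJ_eq_SUP SUP_le_iff)
  finally show ?thesis
    by (simp add: ereal_convex_def)
qed

lemma lower_semicontinuous_conjJ: "lower_semicontinuous (conjJ f)"
  unfolding lower_semicontinuous_def
proof (intro allI impI)
  fix z and c :: ereal
  assume "c < conjJ f z"
  then obtain w where w: "c < ereal (coupling z w) - f w"
    by (auto simp: conjJ_eq_SUP less_SUP_iff)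
  have coupling_lim: "((\<lambda>v. coupling v w) \<longlongrightarrow> coupling z w) (nhds z)"
    by (intro bounded_linear.tendsto[OF bounded_linear_coupling] filterlim_ident)
  have "((\<lambda>v. ereal (coupling v w) - f w) \<longlongrightarrow> ereal (coupling z w) - f w) (nhds z)"
  proof (cases "f w")
    case (real s)
    then show ?thesis
      by (simp add: tendsto_diff coupling_lim)
  qed auto
  then have "\<forall>\<^sub>F v in nhds z. c < ereal (coupling v w) - f w"
    using w by (rule order_tendstoD)
  then show "\<forall>\<^sub>F v in nhds z. c < conjJ f v"
    by (rule eventually_mono) (meson coupling_minus_le_conjJ order_less_le_trans)
qed

text \<open>A single point of \<open>T\<close> suffices in the supremum: maximality supplies one
  whose monotonicity product with \<open>(x, xs)\<close> is nonpositive, namely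
  \<open>(x, xs)\<close> itself when it lies in \<open>T\<close>.\<close>

lemma pairing_le_conjJ:
  assumes T: "maximal_monotone T"
    and f: "\<And>y ys. (y, ys) \<in> T \<Longrightarrow> f (y, ys) = ereal (pairing y ys)"
  shows "ereal (pairing x xs) \<le> conjJ f (x, xs)"
proof -
  obtain y ys where y: "(y, ys) \<in> T" "pairing (x - y) (xs - ys) \<le> 0"
  proof (cases "(x, xs) \<in> T")
    case True
    then show thesis
      by (rule that) simp
  next
    case False
    with T obtain y ys where "(y, ys) \<in> T" "\<not> 0 \<le> pairing (x - y) (xs - ys)"
      unfolding maximal_monotone_def by blast
    then show thesis
      by (metis that linorder_linear)
  qed
  then have "ereal (pairing x xs) \<le> ereal (coupling (x, xs) (y, ys)) - f (y, ys)"
    by (simp add: f pairing_diff_eq_coupling)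
  then show ?thesis
    using coupling_minus_le_conjJ order_trans by blast
qed

text \<open>Only pairs \<open>z\<close>, \<open>w\<close> that involve \<open>z0\<close> are new. If
  just one of them is \<open>z0\<close>, the bound on \<open>conjJ f z0\<close> applies, after a
  swap when it is \<open>w\<close>; if both are, twice the pairing at \<open>z0\<close> must not
  exceed \<open>2 * c\<close>.\<close>

lemma conjJ_fun_upd_le:
  assumes f: "conjJ f \<le> f" and z0: "conjJ f z0 \<le> ereal c" "pairing (fst z0) (snd z0) \<le> c"
  shows "conjJ (f(z0 := ereal c)) \<le> f(z0 := ereal c)"
  unfolding conjJ_le_iff
proof (intro allI)
  fix z w
  have *: "ereal (coupling z0 v) - f v \<le> ereal c" for v
    using coupling_minus_le_conjJ z0(1) by (rule order_trans)
  then have "ereal (coupling v z0) - ereal c \<le> f v" for v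
    by (metis coupling_commute ereal_real_minus_le_swap)
  with * show "ereal (coupling z w) - (f(z0 := ereal c)) w \<le> (f(z0 := ereal c)) z"
    using f[unfolded conjJ_le_iff, rule_format, of z w] z0(2) by (simp add: coupling_self)
qed

theorem theorem2p4:
  fixes T :: "('a::banach \<times> ('a \<Rightarrow>\<^sub>L real)) set"
    and h h0 :: "'a \<times> ('a \<Rightarrow>\<^sub>L real) \<Rightarrow> ereal"
  assumes "maximal_monotone T"
    and "h \<in> convex_representations T"
    and "h \<ge> conjJ h"
    and "h0 \<in> above_conjJ_family T h"
  shows "minimal_element (above_conjJ_family T h) h0 \<longleftrightarrow> h0 = conjJ h0"
proof
  assume fixpoint: "h0 = conjJ h0"
  have "g = h0" if "g \<in> above_conjJ_family T h" "g \<le> h0" for g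
  proof (rule antisym)
    have "conjJ h0 \<le> conjJ g"
      using that(2) by (rule conjJ_antimono)
    also have "\<dots> \<le> g"
      using that(1) by (simp add: above_conjJ_family_def)
    finally show "h0 \<le> g"
      using fixpoint by simp
  qed (rule that(2))
  with assms(4) show "minimal_element (above_conjJ_family T h) h0"
    by (auto simp: minimal_element_def)
next
  assume minimal: "minimal_element (above_conjJ_family T h) h0"
  have h0: "conjJ h0 \<le> h0" "h0 \<le> h" "h0 \<in> convex_representations T"
    using assms(4) by (auto simp: above_conjJ_family_def)
  then have h0_T: "h0 (x, xs) = ereal (pairing x xs)" if "(x, xs) \<in> T" for x xs
    using that by (auto simp: convex_representations_def)
  have pairing_le: "ereal (pairing x xs) \<le> conjJ h0 (x, xs)" for x xs
    using assms(1) h0_T by (rule pairing_le_conjJ)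
  show "h0 = conjJ h0"
  proof (rule ccontr)
    assume "h0 \<noteq> conjJ h0"
    then obtain z where z: "conjJ h0 z < h0 z"
      using h0(1) by (metis antisym_conv2 ext le_funD)
    moreover have z_ge: "ereal (pairing (fst z) (snd z)) \<le> conjJ h0 z"
      using pairing_le[where x = "fst z" and xs = "snd z"] by simp
    \<comment> \<open>The strict inequality excludes \<infinity>, and the lower bound by the pairing
      excludes -\<infinity>.\<close>
    ultimately obtain c where c: "conjJ h0 z = ereal c"
      by (cases "conjJ h0 z") auto
    define m where "m = h0(z := ereal c)"
    define g where "g = conjJ (conjJ m)"
    have "conjJ m \<le> m"
      unfolding m_def using h0(1) c z_ge by (intro conjJ_fun_upd_le) auto
    then have conjJ_m_le: "conjJ m \<le> g"
      unfolding g_def by (rule conjJ_antimono)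
    have g_le_m: "g \<le> m"
      unfolding g_def by (rule conjJ_conjJ_le)
    have "m \<le> h0"
      using z c by (auto simp: m_def le_fun_def)
    then have g_le_h0: "g \<le> h0"
      using g_le_m by simp
    have "conjJ g \<le> conjJ m"
      unfolding g_def by (rule conjJ_conjJ_le)
    then have conjJ_g_le: "conjJ g \<le> g"
      using conjJ_m_le by simp
    \<comment> \<open>This carries the lower bound by the pairing over from \<open>conjJ h0\<close>
      to \<open>g\<close>; on \<open>T\<close> it squeezes \<open>g\<close> against
      \<open>h0\<close>.\<close>
    have "conjJ h0 \<le> g"
      using conjJ_antimono[OF g_le_h0] conjJ_g_le by simp
    then have g_ge: "ereal (pairing x xs) \<le> g (x, xs)" for x xs
      using pairing_le[where x = x and xs = xs] by (meson le_funD order_trans)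
    moreover have "g (x, xs) = ereal (pairing x xs)" if "(x, xs) \<in> T" for x xs
      using g_ge[where x = x and xs = xs] le_funD[OF g_le_h0, of "(x, xs)"] h0_T[OF that] by simp
    ultimately have "g \<in> convex_representations T"
      by (auto simp: convex_representations_def g_def ereal_convex_conjJ
          lower_semicontinuous_conjJ)
    then have "g \<in> above_conjJ_family T h"
      using conjJ_g_le g_le_h0 h0(2) by (auto simp: above_conjJ_family_def)
    then have "g = h0"
      using minimal g_le_h0 by (auto simp: minimal_element_def)
    moreover have "g z < h0 z"
      using le_funD[OF g_le_m, of z] z c by (simp add: m_def)
    ultimately show False
      by simp
  qed
qed

end
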